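(* Let $X$ be the toric variety of a fan $\Sigma$ in $N_{\mathbb R}$, let $\mathcal E$ be a toric sheaf on $X$ with fibre $E$ at $1\in T$ and filtrations $E_\rho^{\bullet}$, $\rho\in\Sigma(1)$, and let $r\in M$. A $\mathbb C$-linear map $\phi:E\to E\otimes N_{\mathbb C}$ induces a homogeneous pre-Higgs field of degree $r$ on $\mathcal E$ if and only if the associated contractions $\phi_s=(\mathrm{id}_E\otimes s)\circ\phi\in\mathrm{End}(E)$ satisfy $$ \phi_s(E_\rho^\ell)\subseteq \begin{cases}E_\rho^{\ell-\langle r,\rho\rangle}&\text{if }s\in\rho^\perp\\ E_\rho^{\ell-1-\langle r,\rho\rangle}&\text{if }s\notin\rho^\perp\end{cases} \qquad\bigl(\text{a subspace of }E_\rho^{\ell-1-\langle r,\rho\rangle}\text{ in both cases}\bigr) $$ for all $s\in M$, $\rho\in\Sigma(1)$ and $\ell\in\mathbb Z$.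
   Context: $N$ is a lattice of finite rank, $M=\mathrm{Hom}_{\mathbb Z}(N,\mathbb Z)$, $N_{\mathbb C}=N\otimes\mathbb C$, $T=N\otimes_{\mathbb Z}\mathbb C^*$ is the torus with neutral element $1\in T\subseteq X$, and $\chi^r$ is the character of $r\in M$. $\Sigma(1)$ is the set of rays of $\Sigma$; $\rho$ denotes both a ray and its primitive generator; $\rho^\perp$ is its annihilator. A toric sheaf $\mathcal E$ is a $T$-equivariant (i.e. $T$-linearized) reflexive sheaf of $\mathcal O_X$-modules; $E=\mathcal E_1/\mathfrak m_{X,1}\mathcal E_1$ is its fibre at $1$. It is encoded (Klyachko) by decreasing $\mathbb Z$-filtrations $E_\rho^{\bullet}=[\cdots\supseteq E_\rho^{\ell}\supseteq E_\rho^{\ell+1}\supseteq\cdots]$ of $E$, one for each $\rho\in\Sigma(1)$, such that, with $U_\rho\subseteq X$ the affine open subset of the ray $\rho$, one has for all $e\in E$, $m\in M$: $e\otimes\chi^m\in\Gamma(U_\rho,\mathcal E)\iff e\in E_\rho^{-\langle m,\rho\rangle}$. For the tangent sheaf $\mathcal T_X$ the vector space is $N_{\mathbb C}$ with filtrations $T_\rho^\ell=N_{\mathbb C}$ for $\ell\le 0$, $T_\rho^1=\mathrm{span}(\rho)$, $T_\rho^\ell=0$ for $\ell\ge 2$. The sheaf $\mathcal F=\mathcal E\otimes_{\mathcal O_X}\mathcal T_X$ is treated as a toric sheaf (in particular as reflexive), with vector space $E\otimes N_{\mathbb C}$ and filtrations $F_\rho^\ell=\sum_{i+j=\ell}E_\rho^i\otimes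 T_\rho^j$. A pre-Higgs field on $\mathcal E$ is an $\mathcal O_X$-linear map $\Phi:\mathcal E\to\mathcal E\otimes_{\mathcal O_X}\mathcal T_X$ (here and throughout, "Higgs" means what is usually called "co-Higgs"). One has $\mathrm{Hom}(\mathcal E,\mathcal F)=\bigoplus_{r\in M}\mathrm{Hom}_T(\mathcal E,\mathcal F[r])\subseteq\mathrm{Hom}(E,E\otimes N_{\mathbb C})\otimes\mathbb C[M]$, where $\mathrm{Hom}_T$ denotes $T$-equivariant morphisms and $\mathcal F[r]$ is $\mathcal F$ with its $T$-action twisted by $\chi^r$ (filtrations $F[r]_\rho^\ell=F_\rho^{\ell-\langle r,\rho\rangle}$). A homogeneous pre-Higgs field of degree $r$ is an element of the $r$-th summand; it has the form $\phi\otimes\chi^r$ with $\phi:E\to E\otimes N_{\mathbb C}$ linear. A linear map $\phi$ "induces a homogeneous pre-Higgs field of degree $r$" if $\phi\otimes\chi^r$ is such an element. Each $s\in M$ is regarded as a $\mathbb C$-linear map $s:N_{\mathbb C}\to\mathbb C$. *)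

theory Defs
  imports "HOL-Analysis.Analysis" "HOL-Library.Poly_Mapping"
begin

section \<open>Lattices, characters and fans\<close>

text \<open>
  A basis of the lattice is fixed, so that \<open>N = \<int>\<^sup>n\<close>; the dual lattice \<open>M = Hom(N, \<int>)\<close> is
  written in the dual basis. Both are \<open>int ^ 'n\<close>, \<open>N\<^sub>\<real>\<close> is \<open>real ^ 'n\<close>, \<open>N\<^sub>\<complex>\<close> is \<open>complex ^ 'n\<close>,
  and the torus \<open>N \<otimes> \<complex>\<^sup>*\<close> is \<open>(\<complex>\<^sup>*)\<^sup>n \<subseteq> complex ^ 'n\<close>.
\<close>

definition pairing :: "int ^ 'n \<Rightarrow> int ^ 'n \<Rightarrow> int" where
  "pairing m v = (\<Sum>i\<in>UNIV. m $ i * v $ i)"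

definition real_of_lattice :: "int ^ 'n \<Rightarrow> real ^ 'n" where
  "real_of_lattice v = (\<chi> i. of_int (v $ i))"

definition complex_of_lattice :: "int ^ 'n \<Rightarrow> complex ^ 'n" where
  "complex_of_lattice v = (\<chi> i. of_int (v $ i))"

definition torus :: "(complex ^ 'n) set" where
  "torus = {t. \<forall>i. t $ i \<noteq> 0}"

definition character :: "int ^ 'n \<Rightarrow> complex ^ 'n \<Rightarrow> complex" where
  "character m t = (\<Prod>i\<in>UNIV. (t $ i) powi (m $ i))"

text \<open>The lattice points of the dual cone, \<open>\<sigma>\<^sup>\<or> \<inter> M\<close>.\<close>

definition dual_cone :: "(real ^ 'n) set \<Rightarrow> (int ^ 'n) set" where
  "dual_cone \<sigma> = {u. \<forall>x\<in>\<sigma>. 0 \<le> real_of_lattice u \<bullet> x}"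

definition rational_cone :: "(real ^ 'n) set \<Rightarrow> bool" where
  "rational_cone \<sigma> \<longleftrightarrow> (\<exists>V. finite V \<and> \<sigma> = convex_cone hull (real_of_lattice ` V))"

definition strongly_convex :: "(real ^ 'n) set \<Rightarrow> bool" where
  "strongly_convex \<sigma> \<longleftrightarrow> \<sigma> \<inter> uminus ` \<sigma> = {0}"

text \<open>The library relation \<open>face_of\<close> admits the empty face, which is not a cone.\<close>

definition fan :: "(real ^ 'n) set set \<Rightarrow> bool" where
  "fan \<Sigma> \<longleftrightarrow> finite \<Sigma> \<and> \<Sigma> \<noteq> {} \<and>
     (\<forall>\<sigma>\<in>\<Sigma>. rational_cone \<sigma> \<and> strongly_convex \<sigma>) \<and>
     (\<forall>\<sigma>\<in>\<Sigma>. \<forall>\<tau>. \<tau> face_of \<sigma> \<and> \<tau> \<noteq> {} \<longrightarrow> \<tau> \<in> \<Sigma>) \<and>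
     (\<forall>\<sigma>\<in>\<Sigma>. \<forall>\<tau>\<in>\<Sigma>. \<sigma> \<inter> \<tau> face_of \<sigma> \<and> \<sigma> \<inter> \<tau> face_of \<tau>)"

definition primitive :: "int ^ 'n \<Rightarrow> bool" where
  "primitive v \<longleftrightarrow> (\<forall>k w. v = k *s w \<longrightarrow> \<bar>k\<bar> = 1)"

definition ray_cone :: "int ^ 'n \<Rightarrow> (real ^ 'n) set" where
  "ray_cone \<rho> = convex_cone hull {real_of_lattice \<rho>}"

text \<open>The rays of the fan, \<open>\<Sigma>(1)\<close>, each given by its primitive generator.\<close>

definition rays :: "(real ^ 'n) set set \<Rightarrow> (int ^ 'n) set" where
  "rays \<Sigma> = {\<rho>. primitive \<rho> \<and> ray_cone \<rho> \<in> \<Sigma>}"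

section \<open>Modules of sections inside \<open>E \<otimes> \<complex>[M]\<close>\<close>

text \<open>
  For a complex vector space \<open>E\<close> with scalar multiplication \<open>smul\<close>, the type
  \<open>(int ^ 'n) \<Rightarrow>\<^sub>0 'e\<close> is \<open>E \<otimes> \<complex>[M]\<close>, with \<open>Poly_Mapping.single m e\<close> being \<open>e \<otimes> \<chi>\<^sup>m\<close>;
  for \<open>E = \<complex>\<close> this is the group ring \<open>\<complex>[M]\<close> (the library's product on \<open>\<Rightarrow>\<^sub>0\<close>).
\<close>

definition act :: "(complex \<Rightarrow> 'e \<Rightarrow> 'e) \<Rightarrow> ((int ^ 'n) \<Rightarrow>\<^sub>0 complex) \<Rightarrow> ((int ^ 'n) \<Rightarrow>\<^sub>0 'e)
    \<Rightarrow> ((int ^ 'n) \<Rightarrow>\<^sub>0 'e::ab_group_add)" where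
  "act smul p f = (\<Sum>u\<in>Poly_Mapping.keys p. \<Sum>m\<in>Poly_Mapping.keys f.
     Poly_Mapping.single (u + m) (smul (Poly_Mapping.lookup p u) (Poly_Mapping.lookup f m)))"

text \<open>The coordinate ring \<open>\<complex>[\<sigma>\<^sup>\<or> \<inter> M]\<close> of the affine chart \<open>U\<^sub>\<sigma>\<close>.\<close>

definition regular_functions :: "(real ^ 'n) set \<Rightarrow> ((int ^ 'n) \<Rightarrow>\<^sub>0 complex) set" where
  "regular_functions \<sigma> = {p. Poly_Mapping.keys p \<subseteq> dual_cone \<sigma>}"

definition submod :: "(complex \<Rightarrow> 'e \<Rightarrow> 'e) \<Rightarrow> ((int ^ 'n) \<Rightarrow>\<^sub>0 complex) set
    \<Rightarrow> ((int ^ 'n) \<Rightarrow>\<^sub>0 'e::ab_group_add) set \<Rightarrow> bool" where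
  "submod smul R S \<longleftrightarrow> 0 \<in> S \<and> (\<forall>f\<in>S. \<forall>g\<in>S. f + g \<in> S) \<and> (\<forall>p\<in>R. \<forall>f\<in>S. act smul p f \<in> S)"

definition fin_gen :: "(complex \<Rightarrow> 'e \<Rightarrow> 'e) \<Rightarrow> ((int ^ 'n) \<Rightarrow>\<^sub>0 complex) set
    \<Rightarrow> ((int ^ 'n) \<Rightarrow>\<^sub>0 'e::ab_group_add) set \<Rightarrow> bool" where
  "fin_gen smul R S \<longleftrightarrow> (\<exists>G. finite G \<and> S = submod smul R hull G)"

definition mod_hom :: "(complex \<Rightarrow> 'e \<Rightarrow> 'e) \<Rightarrow> (complex \<Rightarrow> 'v \<Rightarrow> 'v) \<Rightarrow> ((int ^ 'n) \<Rightarrow>\<^sub>0 complex) set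
    \<Rightarrow> ((int ^ 'n) \<Rightarrow>\<^sub>0 'e::ab_group_add) set \<Rightarrow> ((int ^ 'n) \<Rightarrow>\<^sub>0 'v::ab_group_add) set
    \<Rightarrow> (((int ^ 'n) \<Rightarrow>\<^sub>0 'e) \<Rightarrow> ((int ^ 'n) \<Rightarrow>\<^sub>0 'v)) \<Rightarrow> bool" where
  "mod_hom smul smul' R S S' h \<longleftrightarrow>
     (\<forall>f\<in>S. h f \<in> S') \<and>
     (\<forall>f\<in>S. \<forall>g\<in>S. h (f + g) = h f + h g) \<and>
     (\<forall>p\<in>R. \<forall>f\<in>S. h (act smul p f) = act smul' p (h f))"

text \<open>The dual module \<open>Hom\<^sub>R(S, R)\<close>; functionals are extended by \<open>0\<close> outside \<open>S\<close>, so that equality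
  of elements of the dual is equality of functions.\<close>

definition dual_mod :: "(complex \<Rightarrow> 'e \<Rightarrow> 'e) \<Rightarrow> ((int ^ 'n) \<Rightarrow>\<^sub>0 complex) set
    \<Rightarrow> ((int ^ 'n) \<Rightarrow>\<^sub>0 'e::ab_group_add) set
    \<Rightarrow> (((int ^ 'n) \<Rightarrow>\<^sub>0 'e) \<Rightarrow> ((int ^ 'n) \<Rightarrow>\<^sub>0 complex)) set" where
  "dual_mod smul R S = {h. mod_hom smul (*) R S R h \<and> (\<forall>f. f \<notin> S \<longrightarrow> h f = 0)}"

text \<open>The evaluation map from \<open>S\<close> to its double dual is bijective.\<close>

definition reflexive :: "(complex \<Rightarrow> 'e \<Rightarrow> 'e) \<Rightarrow> ((int ^ 'n) \<Rightarrow>\<^sub>0 complex) set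
    \<Rightarrow> ((int ^ 'n) \<Rightarrow>\<^sub>0 'e::ab_group_add) set \<Rightarrow> bool" where
  "reflexive smul R S \<longleftrightarrow>
     (\<forall>\<psi>. (\<forall>h\<in>dual_mod smul R S. \<psi> h \<in> R) \<and>
          (\<forall>h\<in>dual_mod smul R S. \<forall>k\<in>dual_mod smul R S. \<psi> (\<lambda>f. h f + k f) = \<psi> h + \<psi> k) \<and>
          (\<forall>p\<in>R. \<forall>h\<in>dual_mod smul R S. \<psi> (\<lambda>f. p * h f) = p * \<psi> h) \<longrightarrow>
          (\<exists>!f. f \<in> S \<and> (\<forall>h\<in>dual_mod smul R S. \<psi> h = h f)))"

section \<open>Toric sheaves\<close>

text \<open>The geometric action of the torus, under which \<open>\<chi>\<^sup>m\<close> is multiplied by \<open>\<chi>\<^sup>m(t)\<^sup>-\<^sup>1\<close>, and its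
  twist by \<open>\<chi>\<^sup>r\<close>. For this sign an equivariant map into the twist raises \<open>M\<close>-degrees by \<open>r\<close>.\<close>

definition torus_action :: "(complex \<Rightarrow> 'e \<Rightarrow> 'e) \<Rightarrow> complex ^ 'n \<Rightarrow> ((int ^ 'n) \<Rightarrow>\<^sub>0 'e)
    \<Rightarrow> ((int ^ 'n) \<Rightarrow>\<^sub>0 'e::ab_group_add)" where
  "torus_action smul t f = Poly_Mapping.mapp (\<lambda>m. smul (inverse (character m t))) f"

definition twisted_action :: "(complex \<Rightarrow> 'e \<Rightarrow> 'e) \<Rightarrow> int ^ 'n \<Rightarrow> complex ^ 'n
    \<Rightarrow> ((int ^ 'n) \<Rightarrow>\<^sub>0 'e) \<Rightarrow> ((int ^ 'n) \<Rightarrow>\<^sub>0 'e::ab_group_add)" where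
  "twisted_action smul r t f = Poly_Mapping.map (smul (character r t)) (torus_action smul t f)"

text \<open>
  Quasi-coherent sheaves on the toric variety \<open>X\<close> of \<open>\<Sigma>\<close> are given by their modules of sections over the
  affine charts \<open>U\<^sub>\<sigma>\<close>, \<open>\<sigma> \<in> \<Sigma>\<close>, where \<open>U\<^sub>\<sigma> \<inter> U\<^sub>\<sigma>\<^sub>' = U\<^bsub>\<sigma> \<inter> \<sigma>'\<^esub>\<close>. A \<open>T\<close>-linearized reflexive (hence
  torsion-free) sheaf restricts over \<open>T = U\<^bsub>{0}\<^esub>\<close> to \<open>E \<otimes> \<O>\<^sub>T\<close> with \<open>E\<close> the fibre at \<open>1\<close>, and
  restriction to \<open>T\<close> embeds its sections over every chart into \<open>E \<otimes> \<complex>[M]\<close>. Thus \<open>S \<sigma>\<close> is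
  \<open>\<Gamma>(U\<^sub>\<sigma>, \<E>) \<subseteq> E \<otimes> \<complex>[M]\<close>, and all restriction maps are inclusions. Quasi-coherence says
  that \<open>S \<tau> = \<O>(U\<^sub>\<tau>) \<cdot> S \<sigma>\<close> for faces \<open>\<tau>\<close> of \<open>\<sigma>\<close>. Finite generation over \<open>{0}\<close>
  makes \<open>E\<close> finite-dimensional.
\<close>

definition toric_sheaf :: "(complex \<Rightarrow> 'e \<Rightarrow> 'e) \<Rightarrow> (real ^ 'n) set set
    \<Rightarrow> ((real ^ 'n) set \<Rightarrow> ((int ^ 'n) \<Rightarrow>\<^sub>0 'e::ab_group_add) set) \<Rightarrow> bool" where
  "toric_sheaf smul \<Sigma> S \<longleftrightarrow>
     (\<forall>\<sigma>\<in>\<Sigma>. submod smul (regular_functions \<sigma>) (S \<sigma>) \<and>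
             fin_gen smul (regular_functions \<sigma>) (S \<sigma>) \<and>
             reflexive smul (regular_functions \<sigma>) (S \<sigma>) \<and>
             (\<forall>t\<in>torus. \<forall>f\<in>S \<sigma>. torus_action smul t f \<in> S \<sigma>)) \<and>
     (\<forall>\<sigma>\<in>\<Sigma>. \<forall>\<tau>\<in>\<Sigma>. \<tau> face_of \<sigma> \<longrightarrow> S \<tau> = submod smul (regular_functions \<tau>) hull S \<sigma>) \<and>
     S {0} = UNIV"

text \<open>The filtration \<open>E\<^sub>\<rho>\<^sup>l\<close>. Its defining property is \<open>filtration_iff\<close> below.\<close>

definition filtration :: "((real ^ 'n) set \<Rightarrow> ((int ^ 'n) \<Rightarrow>\<^sub>0 'e::ab_group_add) set)
    \<Rightarrow> int ^ 'n \<Rightarrow> int \<Rightarrow> 'e set" where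
  "filtration S \<rho> l = {e. \<forall>m. pairing m \<rho> = - l \<longrightarrow> Poly_Mapping.single m e \<in> S (ray_cone \<rho>)}"

text \<open>The toric sheaf with given filtrations: by reflexivity, its sections over \<open>U\<^sub>\<sigma>\<close> are those
  sections over \<open>T\<close> that extend to \<open>U\<^sub>\<rho>\<close> for every ray \<open>\<rho>\<close> of \<open>\<sigma>\<close>.\<close>

definition sheaf_of_filtration :: "(real ^ 'n) set set \<Rightarrow> (int ^ 'n \<Rightarrow> int \<Rightarrow> 'v set)
    \<Rightarrow> (real ^ 'n) set \<Rightarrow> ((int ^ 'n) \<Rightarrow>\<^sub>0 'v::ab_group_add) set" where
  "sheaf_of_filtration \<Sigma> F \<sigma> =
     {f. \<forall>\<rho>\<in>rays \<Sigma>. ray_cone \<rho> \<subseteq> \<sigma> \<longrightarrow>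
           (\<forall>m. Poly_Mapping.lookup f m \<in> F \<rho> (- pairing m \<rho>))}"

definition sheaf_hom :: "(complex \<Rightarrow> 'e \<Rightarrow> 'e) \<Rightarrow> (complex \<Rightarrow> 'v \<Rightarrow> 'v) \<Rightarrow> (real ^ 'n) set set
    \<Rightarrow> ((real ^ 'n) set \<Rightarrow> ((int ^ 'n) \<Rightarrow>\<^sub>0 'e::ab_group_add) set)
    \<Rightarrow> ((real ^ 'n) set \<Rightarrow> ((int ^ 'n) \<Rightarrow>\<^sub>0 'v::ab_group_add) set)
    \<Rightarrow> ((real ^ 'n) set \<Rightarrow> ((int ^ 'n) \<Rightarrow>\<^sub>0 'e) \<Rightarrow> ((int ^ 'n) \<Rightarrow>\<^sub>0 'v)) \<Rightarrow> bool" where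
  "sheaf_hom smul smul' \<Sigma> S S' \<Phi> \<longleftrightarrow>
     (\<forall>\<sigma>\<in>\<Sigma>. mod_hom smul smul' (regular_functions \<sigma>) (S \<sigma>) (S' \<sigma>) (\<Phi> \<sigma>)) \<and>
     (\<forall>\<sigma>\<in>\<Sigma>. \<forall>\<tau>\<in>\<Sigma>. \<tau> face_of \<sigma> \<longrightarrow> (\<forall>f\<in>S \<sigma>. \<Phi> \<tau> f = \<Phi> \<sigma> f))"

section \<open>Pre-Higgs fields\<close>

text \<open>The tensor product \<open>E \<otimes> N\<^sub>\<complex> = E \<otimes> \<complex>\<^sup>n\<close> is \<open>E\<^sup>n\<close>.\<close>

definition scale_tensor :: "(complex \<Rightarrow> 'e \<Rightarrow> 'e) \<Rightarrow> complex \<Rightarrow> 'e ^ 'n \<Rightarrow> 'e ^ 'n" where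
  "scale_tensor smul c w = (\<chi> i. smul c (w $ i))"

definition tensor :: "(complex \<Rightarrow> 'e \<Rightarrow> 'e) \<Rightarrow> 'e \<Rightarrow> complex ^ 'n \<Rightarrow> 'e ^ 'n" where
  "tensor smul e v = (\<chi> i. smul (v $ i) e)"

text \<open>The map \<open>id\<^sub>E \<otimes> s\<close>; see \<open>contract_tensor\<close> below.\<close>

definition contract :: "(complex \<Rightarrow> 'e \<Rightarrow> 'e) \<Rightarrow> int ^ 'n \<Rightarrow> 'e ^ 'n \<Rightarrow> 'e::ab_group_add" where
  "contract smul s w = (\<Sum>i\<in>UNIV. smul (of_int (s $ i)) (w $ i))"

definition tangent_filtration :: "int ^ 'n \<Rightarrow> int \<Rightarrow> (complex ^ 'n) set" where
  "tangent_filtration \<rho> l =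
     (if l \<le> 0 then UNIV
      else if l = 1 then range (\<lambda>c. c *s complex_of_lattice \<rho>)
      else {0})"

definition tensor_tangent_filtration :: "(complex \<Rightarrow> 'e \<Rightarrow> 'e) \<Rightarrow> (int ^ 'n \<Rightarrow> int \<Rightarrow> 'e set)
    \<Rightarrow> int ^ 'n \<Rightarrow> int \<Rightarrow> ('e::ab_group_add ^ 'n) set" where
  "tensor_tangent_filtration smul F \<rho> l =
     module.span (scale_tensor smul)
       {tensor smul e v | e v i j. i + j = l \<and> e \<in> F \<rho> i \<and> v \<in> tangent_filtration \<rho> j}"

definition tensor_tangent :: "(complex \<Rightarrow> 'e \<Rightarrow> 'e) \<Rightarrow> (real ^ 'n) set set
    \<Rightarrow> ((real ^ 'n) set \<Rightarrow> ((int ^ 'n) \<Rightarrow>\<^sub>0 'e::ab_group_add) set)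
    \<Rightarrow> (real ^ 'n) set \<Rightarrow> ((int ^ 'n) \<Rightarrow>\<^sub>0 ('e ^ 'n)) set" where
  "tensor_tangent smul \<Sigma> S =
     sheaf_of_filtration \<Sigma> (tensor_tangent_filtration smul (filtration S))"

definition pre_higgs :: "(complex \<Rightarrow> 'e \<Rightarrow> 'e) \<Rightarrow> (real ^ 'n) set set
    \<Rightarrow> ((real ^ 'n) set \<Rightarrow> ((int ^ 'n) \<Rightarrow>\<^sub>0 'e::ab_group_add) set)
    \<Rightarrow> ((real ^ 'n) set \<Rightarrow> ((int ^ 'n) \<Rightarrow>\<^sub>0 'e) \<Rightarrow> ((int ^ 'n) \<Rightarrow>\<^sub>0 ('e ^ 'n))) \<Rightarrow> bool" where
  "pre_higgs smul \<Sigma> S \<Phi> \<longleftrightarrow>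
     sheaf_hom smul (scale_tensor smul) \<Sigma> S (tensor_tangent smul \<Sigma> S) \<Phi>"

text \<open>Homogeneity of degree \<open>r\<close>: equivariance as a map into the target twisted by \<open>\<chi>\<^sup>r\<close>.\<close>

definition homogeneous_pre_higgs :: "(complex \<Rightarrow> 'e \<Rightarrow> 'e) \<Rightarrow> (real ^ 'n) set set
    \<Rightarrow> ((real ^ 'n) set \<Rightarrow> ((int ^ 'n) \<Rightarrow>\<^sub>0 'e::ab_group_add) set) \<Rightarrow> int ^ 'n
    \<Rightarrow> ((real ^ 'n) set \<Rightarrow> ((int ^ 'n) \<Rightarrow>\<^sub>0 'e) \<Rightarrow> ((int ^ 'n) \<Rightarrow>\<^sub>0 ('e ^ 'n))) \<Rightarrow> bool" where
  "homogeneous_pre_higgs smul \<Sigma> S r \<Phi> \<longleftrightarrow>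
     pre_higgs smul \<Sigma> S \<Phi> \<and>
     (\<forall>\<sigma>\<in>\<Sigma>. \<forall>t\<in>torus. \<forall>f\<in>S \<sigma>.
        \<Phi> \<sigma> (torus_action smul t f) = twisted_action (scale_tensor smul) r t (\<Phi> \<sigma> f))"

text \<open>A morphism is identified with its restriction to \<open>T = U\<^bsub>{0}\<^esub>\<close>, and \<open>\<phi> \<otimes> \<chi>\<^sup>r\<close> is the morphism
  with restriction \<open>e \<otimes> \<chi>\<^sup>m \<mapsto> \<phi>(e) \<otimes> \<chi>\<^sup>m\<^sup>+\<^sup>r\<close>.\<close>

definition induces_homogeneous_pre_higgs :: "(complex \<Rightarrow> 'e \<Rightarrow> 'e) \<Rightarrow> (real ^ 'n) set set
    \<Rightarrow> ((real ^ 'n) set \<Rightarrow> ((int ^ 'n) \<Rightarrow>\<^sub>0 'e::ab_group_add) set) \<Rightarrow> int ^ 'n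
    \<Rightarrow> ('e \<Rightarrow> 'e ^ 'n) \<Rightarrow> bool" where
  "induces_homogeneous_pre_higgs smul \<Sigma> S r \<phi> \<longleftrightarrow>
     (\<exists>\<Phi>. homogeneous_pre_higgs smul \<Sigma> S r \<Phi> \<and>
        (\<forall>e m. \<Phi> {0} (Poly_Mapping.single m e) = Poly_Mapping.single (m + r) (\<phi> e)))"

section \<open>Basic properties\<close>

lemma fan_zero:
  assumes "fan \<Sigma>"
  shows "{0} \<in> \<Sigma>"
proof -
  have "\<Sigma> \<noteq> {}" and cones: "\<forall>\<sigma>\<in>\<Sigma>. rational_cone \<sigma> \<and> strongly_convex \<sigma>"
    and faces: "\<forall>\<sigma>\<in>\<Sigma>. \<forall>\<tau>. \<tau> face_of \<sigma> \<and> \<tau> \<noteq> {} \<longrightarrow> \<tau> \<in> \<Sigma>"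
    using assms unfolding fan_def by simp_all
  then obtain \<sigma> where \<sigma>: "\<sigma> \<in> \<Sigma>" by blast
  have "rational_cone \<sigma>" and pt: "\<sigma> \<inter> uminus ` \<sigma> = {0}"
    using cones \<sigma> unfolding strongly_convex_def by simp_all
  then have cc: "convex_cone \<sigma>"
    unfolding rational_cone_def using convex_cone_convex_cone_hull by metis
  have "a = 0 \<and> b = 0" if a: "a \<in> \<sigma>" and b: "b \<in> \<sigma>" and seg: "0 \<in> open_segment a b" for a b
  proof -
    obtain u where u: "0 < u" "u < 1" "0 = (1 - u) *\<^sub>R a + u *\<^sub>R b"
      using seg unfolding in_segment by blast
    have in1: "(1 - u) *\<^sub>R a \<in> \<sigma>"
      using u(2) by (intro convex_cone_scaleR[OF cc _ a]) simp
    have in2: "u *\<^sub>R b \<in> \<sigma>"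
      using u(1) by (intro convex_cone_scaleR[OF cc _ b]) simp
    have "(1 - u) *\<^sub>R a = - (u *\<^sub>R b)"
      using u(3)[symmetric] by (simp only: eq_neg_iff_add_eq_0)
    then have "(1 - u) *\<^sub>R a \<in> uminus ` \<sigma>"
      using imageI[OF in2, of uminus] by (simp only:)
    with in1 have "(1 - u) *\<^sub>R a = 0" using pt by blast
    then have a0: "a = 0" using u(2) by simp
    have "u *\<^sub>R b = 0" using u(3) unfolding a0 by simp
    then show ?thesis using u(1) a0 by simp
  qed
  moreover have "0 \<in> \<sigma>" using pt by blast
  ultimately have "{0} face_of \<sigma>"
    unfolding face_of_def by simp
  then show ?thesis using faces \<sigma> by blast
qed

lemma act_single:
  assumes "vector_space smul"
  shows "act smul (Poly_Mapping.single u 1) (Poly_Mapping.single m e) = Poly_Mapping.single (u + m) e"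
proof -
  interpret vector_space smul by fact
  show ?thesis by (cases "e = 0") (auto simp: act_def)
qed

lemma filtration_iff:
  assumes vs: "vector_space smul" and ts: "toric_sheaf smul \<Sigma> S" and \<rho>: "\<rho> \<in> rays \<Sigma>"
  shows "Poly_Mapping.single m e \<in> S (ray_cone \<rho>) \<longleftrightarrow> e \<in> filtration S \<rho> (- pairing m \<rho>)"
proof
  assume e: "Poly_Mapping.single m e \<in> S (ray_cone \<rho>)"
  have sub: "submod smul (regular_functions (ray_cone \<rho>)) (S (ray_cone \<rho>))"
    using ts \<rho> unfolding toric_sheaf_def rays_def by blast
  have "Poly_Mapping.single m' e \<in> S (ray_cone \<rho>)" if m': "pairing m' \<rho> = pairing m \<rho>" for m'
  proof -
    have "real_of_lattice (m' - m) \<bullet> real_of_lattice \<rho> = of_int (pairing m' \<rho> - pairing m \<rho>)"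
      by (simp add: real_of_lattice_def pairing_def inner_vec_def sum_subtractf left_diff_distrib)
    then have z: "real_of_lattice (m' - m) \<bullet> real_of_lattice \<rho> = 0" using m' by simp
    have "convex_cone {x. real_of_lattice (m' - m) \<bullet> x = 0}"
      unfolding convex_cone_def conic_def
      by (simp add: convex_hyperplane) (metis inner_zero_right)
    then have "ray_cone \<rho> \<subseteq> {x. real_of_lattice (m' - m) \<bullet> x = 0}"
      unfolding ray_cone_def by (rule hull_minimal[rotated]) (simp add: z)
    then have "Poly_Mapping.single (m' - m) 1 \<in> regular_functions (ray_cone \<rho>)"
      by (auto simp: regular_functions_def dual_cone_def)
    then have "act smul (Poly_Mapping.single (m' - m) 1) (Poly_Mapping.single m e) \<in> S (ray_cone \<rho>)"
      using sub e unfolding submod_def by blast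
    then show ?thesis by (simp add: act_single[OF vs])
  qed
  then show "e \<in> filtration S \<rho> (- pairing m \<rho>)" by (simp add: filtration_def)
qed (simp add: filtration_def)

lemma contract_tensor:
  assumes "vector_space smul"
  shows "contract smul s (tensor smul e v) = smul (\<Sum>i\<in>UNIV. of_int (s $ i) * v $ i) e"
proof -
  interpret vector_space smul by fact
  show ?thesis by (simp add: contract_def tensor_def scale_sum_left)
qed

end

theory Submission
  imports Defs
begin

text \<open>
  The heart of the matter is linear algebra at a single ray \<open>\<rho>\<close>. As \<open>\<rho>\<close> is primitive, some \<open>u \<in> M\<close>
  satisfies \<open>\<langle>u, \<rho>\<rangle> = 1\<close>, and it splits \<open>N\<^sub>\<complex>\<close> as the direct sum of the line of \<open>\<rho>\<close> and \<open>ker u\<close>.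
  Accordingly every \<open>w \<in> E \<otimes> N\<^sub>\<complex>\<close> is \<open>w\<^sub>u \<otimes> \<rho> + w'\<close>, where \<open>w\<^sub>u\<close> is the contraction of \<open>w\<close> with \<open>u\<close>
  and the coordinates of \<open>w'\<close> are the contractions of \<open>w\<close> with \<open>e\<^sub>i - \<rho>\<^sub>i u \<in> \<rho>\<^sup>\<bottom>\<close>. Since the
  filtration of the tangent sheaf only distinguishes the line of \<open>\<rho>\<close> (weight 1) from the rest
  (weight 0), the subspace \<open>F\<^sub>\<rho>\<^sup>l\<close> of \<open>E \<otimes> N\<^sub>\<complex>\<close> consists of the \<open>w\<close> whose contractions lie in \<open>E\<^sub>\<rho>\<^sup>l\<close> for
  \<open>s \<in> \<rho>\<^sup>\<bottom>\<close> and in \<open>E\<^sub>\<rho>\<^sup>l\<^sup>-\<^sup>1\<close> for all other \<open>s\<close>: this is \<open>tensor_tangent_filtration_iff\<close>.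

  It remains to see that \<open>\<phi>\<close> induces a homogeneous pre-Higgs field of degree \<open>r\<close> exactly if it maps
  \<open>E\<^sub>\<rho>\<^sup>l\<close> into \<open>F\<^sub>\<rho>\<^sup>k\<close> with \<open>k = l - \<langle>r, \<rho>\<rangle>\<close>, for all \<open>\<rho>\<close> and \<open>l\<close>
  (\<open>induces_homogeneous_pre_higgs_iff\<close>). Necessity is read off from homogeneous sections over
  \<open>U\<^sub>\<rho>\<close>. For sufficiency, \<open>\<phi> \<otimes> \<chi>\<^sup>r\<close> is applied to an
  arbitrary section over a chart; because the sections over \<open>U\<^sub>\<rho>\<close> are stable under the torus, they
  contain the homogeneous components of each of their elements (\<open>homogeneous_component_in\<close>), so the
  inclusion of filtrations can be used in each degree separately.
\<close>

section \<open>Lattice points and characters\<close>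

lemma bezout_family:
  fixes v :: "'a \<Rightarrow> int"
  assumes "finite A"
  shows "\<exists>u. \<forall>i\<in>A. (\<Sum>j\<in>A. u j * v j) dvd v i"
  using assms
proof (induction A rule: finite_induct)
  case empty
  then show ?case by simp
next
  case (insert a A)
  then obtain u where u: "\<forall>i\<in>A. (\<Sum>j\<in>A. u j * v j) dvd v i" by blast
  define d where "d = (\<Sum>j\<in>A. u j * v j)"
  obtain x y where xy: "x * d + y * v a = gcd d (v a)"
    using bezout_int by blast
  define u' where "u' j = (if j = a then y else x * u j)" for j
  have "(\<Sum>j\<in>A. u' j * v j) = (\<Sum>j\<in>A. x * (u j * v j))"
    using insert.hyps(2) by (intro sum.cong) (auto simp: u'_def)
  also have "\<dots> = x * d" by (simp add: d_def sum_distrib_left)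
  finally have "(\<Sum>j\<in>insert a A. u' j * v j) = gcd d (v a)"
    using insert.hyps xy by (simp add: u'_def)
  moreover have "gcd d (v a) dvd v i" if "i \<in> insert a A" for i
    using that u by (auto simp: d_def intro: dvd_trans[OF gcd_dvd1])
  ultimately show ?case by (intro exI[of _ u']) simp
qed

text \<open>A Bezout combination \<open>d\<close> of the coordinates of \<open>\<rho>\<close> that divides all of them can be split off as
  a factor of \<open>\<rho>\<close>, so primitivity forces \<open>d\<close> to be \<open>1\<close> or \<open>-1\<close>.\<close>

lemma primitive_dual:
  fixes \<rho> :: "int ^ 'n"
  assumes "primitive \<rho>"
  obtains u where "pairing u \<rho> = 1"
proof -
  obtain u where u: "\<forall>i\<in>UNIV. (\<Sum>j\<in>UNIV. u j * \<rho> $ j) dvd \<rho> $ i"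
    using bezout_family[of "UNIV :: 'n set" "\<lambda>i. \<rho> $ i"] by auto
  define d where "d = (\<Sum>j\<in>UNIV. u j * \<rho> $ j)"
  have "\<rho> = d *s (\<chi> i. \<rho> $ i div d)"
    using u by (simp add: vec_eq_iff d_def)
  then have "\<bar>d\<bar> = 1" using assms unfolding primitive_def by blast
  then have "d * d = 1" by (metis abs_mult_self_eq mult_1)
  moreover have "pairing (\<chi> j. d * u j) \<rho> = d * d"
    by (simp add: pairing_def d_def[symmetric] mult.assoc flip: sum_distrib_left)
  ultimately show thesis using that by metis
qed

lemma pairing_simps [simp]:
  "pairing (m + m') v = pairing m v + pairing m' v"
  "pairing (m - m') v = pairing m v - pairing m' v"
  "pairing (k *s m) v = k * pairing m v"
  "pairing 0 v = 0"
  "pairing (axis i 1) v = v $ i"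
  by (simp_all add: pairing_def distrib_right sum.distrib left_diff_distrib sum_subtractf
      sum_distrib_left mult.assoc axis_def if_distrib[of "\<lambda>x. x * _"] cong: if_cong)

lemma real_of_lattice_inner:
  "real_of_lattice u \<bullet> real_of_lattice v = of_int (pairing u v)"
  by (simp add: real_of_lattice_def pairing_def inner_vec_def)

lemma dual_cone_ray_cone_iff: "u \<in> dual_cone (ray_cone \<rho>) \<longleftrightarrow> 0 \<le> pairing u \<rho>"
proof
  assume "u \<in> dual_cone (ray_cone \<rho>)"
  then have "0 \<le> real_of_lattice u \<bullet> real_of_lattice \<rho>"
    by (simp add: dual_cone_def ray_cone_def hull_inc)
  then show "0 \<le> pairing u \<rho>" by (simp add: real_of_lattice_inner)
next
  assume "0 \<le> pairing u \<rho>"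
  moreover have "convex_cone {x. 0 \<le> real_of_lattice u \<bullet> x}"
    unfolding convex_cone_def conic_def
    using convex_halfspace_ge[of 0 "real_of_lattice u"] by (auto simp: exI[of _ 0])
  ultimately have "ray_cone \<rho> \<subseteq> {x. 0 \<le> real_of_lattice u \<bullet> x}"
    unfolding ray_cone_def by (intro hull_minimal) (auto simp: real_of_lattice_inner)
  then show "u \<in> dual_cone (ray_cone \<rho>)" by (auto simp: dual_cone_def)
qed

lemma character_nonzero: "t \<in> torus \<Longrightarrow> character m t \<noteq> 0"
  by (simp add: character_def torus_def)

lemma character_add: "t \<in> torus \<Longrightarrow> character (m + m') t = character m t * character m' t"
  by (simp add: character_def torus_def power_int_add prod.distrib)

lemma characters_separate:
  assumes "m \<noteq> m'"
  obtains t where "t \<in> torus" "character m t \<noteq> character m' t"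
proof -
  obtain i where i: "m $ i \<noteq> m' $ i" using assms by (auto simp: vec_eq_iff)
  define t :: "complex ^ 'a" where "t = (\<chi> j. if j = i then 2 else 1)"
  have ch: "character k t = 2 powi (k $ i)" for k
  proof -
    have "character k t = (\<Prod>j\<in>UNIV. if j = i then 2 powi (k $ i) else 1)"
      unfolding character_def t_def by (intro prod.cong) auto
    then show ?thesis by simp
  qed
  have "(2::real) powi (m $ i) \<noteq> 2 powi (m' $ i)"
    using i power_int_strict_increasing[of "m $ i" "m' $ i" "2::real"]
      power_int_strict_increasing[of "m' $ i" "m $ i" "2::real"] by fastforce
  then have "complex_of_real (2 powi (m $ i)) \<noteq> complex_of_real (2 powi (m' $ i))"
    by (simp only: of_real_eq_iff not_False_eq_True)
  then have "(2::complex) powi (m $ i) \<noteq> 2 powi (m' $ i)"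
    by (simp only: of_real_power_int of_real_numeral not_False_eq_True)
  moreover have "t \<in> torus" by (simp add: t_def torus_def)
  ultimately show thesis using that[of t] ch by simp
qed

section \<open>Sections and their homogeneous components\<close>

lemma lookup_act:
  assumes "vector_space smul"
  shows "Poly_Mapping.lookup (act smul p f) k =
    (\<Sum>u\<in>Poly_Mapping.keys p. smul (Poly_Mapping.lookup p u) (Poly_Mapping.lookup f (k - u)))"
proof -
  interpret vector_space smul by fact
  have "(\<Sum>m\<in>Poly_Mapping.keys f. smul c (Poly_Mapping.lookup f m) when u + m = k)
      = smul c (Poly_Mapping.lookup f (k - u))" for c u
  proof -
    have "(\<Sum>m\<in>Poly_Mapping.keys f. smul c (Poly_Mapping.lookup f m) when u + m = k)
      = (\<Sum>m\<in>Poly_Mapping.keys f. if m = k - u then smul c (Poly_Mapping.lookup f m) else 0)"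
      by (intro sum.cong) (auto simp: when_def algebra_simps)
    then show ?thesis by (simp add: in_keys_iff)
  qed
  then show ?thesis
    by (simp add: act_def lookup_sum lookup_single)
qed

lemma lookup_act_constant:
  assumes "vector_space smul"
  shows "Poly_Mapping.lookup (act smul (Poly_Mapping.single 0 c) f) k
    = smul c (Poly_Mapping.lookup f k)"
proof -
  interpret vector_space smul by fact
  show ?thesis by (simp add: lookup_act[OF assms])
qed

lemma lookup_torus_action:
  assumes "vector_space smul"
  shows "Poly_Mapping.lookup (torus_action smul t f) m
    = smul (inverse (character m t)) (Poly_Mapping.lookup f m)"
proof -
  interpret vector_space smul by fact
  show ?thesis by (simp add: torus_action_def lookup_mapp when_def in_keys_iff)
qed

lemma lookup_twisted_action:
  assumes "vector_space smul"
  shows "Poly_Mapping.lookup (twisted_action smul r t f) m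
    = smul (character r t * inverse (character m t)) (Poly_Mapping.lookup f m)"
proof -
  interpret vector_space smul by fact
  show ?thesis
    by (simp add: twisted_action_def map.rep_eq when_def lookup_torus_action[OF assms])
qed

text \<open>
  Torus-stable submodules are graded. Since characters separate points of \<open>M\<close>, a suitable
  combination of \<open>f\<close> and \<open>t \<cdot> f\<close> removes one unwanted component of \<open>f\<close> while keeping the component
  in degree \<open>m\<close>; after finitely many such steps only the latter is left.
\<close>

lemma homogeneous_component_in:
  assumes vs: "vector_space smul"
    and sub: "submod smul (regular_functions \<sigma>) S"
    and stable: "\<And>t f. t \<in> torus \<Longrightarrow> f \<in> S \<Longrightarrow> torus_action smul t f \<in> S"
    and f: "f \<in> S"
  shows "Poly_Mapping.single m (Poly_Mapping.lookup f m) \<in> S"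
proof -
  interpret vector_space smul by fact
  have add: "g + h \<in> S" if "g \<in> S" "h \<in> S" for g h
    using sub that unfolding submod_def by blast
  have const: "Poly_Mapping.single 0 c \<in> regular_functions \<sigma>" for c
    by (auto simp: regular_functions_def dual_cone_def real_of_lattice_def inner_vec_def)
  have scale: "act smul (Poly_Mapping.single 0 c) g \<in> S" if "g \<in> S" for c g
    using sub that const unfolding submod_def by blast
  have "\<exists>g\<in>S. Poly_Mapping.lookup g m = Poly_Mapping.lookup f m \<and>
      (\<forall>k\<in>A. Poly_Mapping.lookup g k = 0) \<and>
      (\<forall>k. Poly_Mapping.lookup f k = 0 \<longrightarrow> Poly_Mapping.lookup g k = 0)"
    if "finite A" "m \<notin> A" for A
    using that
  proof (induction A rule: finite_induct)
    case empty
    then show ?case using f by blast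
  next
    case (insert a A)
    then obtain g where g: "g \<in> S" "Poly_Mapping.lookup g m = Poly_Mapping.lookup f m"
      "\<forall>k\<in>A. Poly_Mapping.lookup g k = 0"
      "\<forall>k. Poly_Mapping.lookup f k = 0 \<longrightarrow> Poly_Mapping.lookup g k = 0" by blast
    from insert.prems have "a \<noteq> m" by auto
    then obtain t where t: "t \<in> torus" "character a t \<noteq> character m t"
      by (rule characters_separate)
    define x where "x = character a t"
    define y where "y = character m t"
    have xy: "x \<noteq> 0" "y \<noteq> 0" "x \<noteq> y"
      using t character_nonzero by (auto simp: x_def y_def)
    define c where "c = inverse (1 - x * inverse y)"
    have c: "c * (1 - x * inverse y) = 1"
      using xy by (simp add: c_def field_simps)
    \<comment> \<open>Multiplies the component in degree \<open>k\<close> by \<open>c (1 - \<chi>\<^sup>a(t) / \<chi>\<^sup>k(t))\<close>, which is 0 for \<open>k = a\<close>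
      and, by the choice of \<open>c\<close>, is 1 for \<open>k = m\<close>.\<close>
    define h where "h = act smul (Poly_Mapping.single 0 c) g +
      act smul (Poly_Mapping.single 0 (- c * x)) (torus_action smul t g)"
    have h: "Poly_Mapping.lookup h k
        = smul (c * (1 - x * inverse (character k t))) (Poly_Mapping.lookup g k)" for k
      by (simp add: h_def lookup_add lookup_act_constant[OF vs] lookup_torus_action[OF vs]
          scale_left_diff_distrib right_diff_distrib mult.assoc)
    have "h \<in> S" unfolding h_def by (intro add scale stable g t)
    moreover have "Poly_Mapping.lookup h m = Poly_Mapping.lookup f m"
      unfolding h y_def[symmetric] c by (simp add: g)
    moreover have "Poly_Mapping.lookup h a = 0"
      using xy by (simp add: h x_def[symmetric])
    ultimately show ?case using g by (intro bexI[of _ h]) (auto simp: h)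
  qed
  from this[of "Poly_Mapping.keys f - {m}"] obtain g where g: "g \<in> S"
    "Poly_Mapping.lookup g m = Poly_Mapping.lookup f m"
    "\<forall>k\<in>Poly_Mapping.keys f - {m}. Poly_Mapping.lookup g k = 0"
    "\<forall>k. Poly_Mapping.lookup f k = 0 \<longrightarrow> Poly_Mapping.lookup g k = 0" by auto
  have "g = Poly_Mapping.single m (Poly_Mapping.lookup f m)"
  proof (rule poly_mapping_eqI)
    fix k
    show "Poly_Mapping.lookup g k
        = Poly_Mapping.lookup (Poly_Mapping.single m (Poly_Mapping.lookup f m)) k"
      using g(2-4) by (cases "k = m"; cases "Poly_Mapping.lookup f k = 0")
        (auto simp: lookup_single in_keys_iff)
  qed
  with g show ?thesis by simp
qed

section \<open>The filtration of a toric sheaf\<close>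

lemma filtration_subspace:
  assumes vs: "vector_space smul" and ts: "toric_sheaf smul \<Sigma> S" and \<rho>: "\<rho> \<in> rays \<Sigma>"
  shows "module.subspace smul (filtration S \<rho> l)"
proof -
  interpret vector_space smul by fact
  have sub: "submod smul (regular_functions (ray_cone \<rho>)) (S (ray_cone \<rho>))"
    using ts \<rho> unfolding toric_sheaf_def rays_def by blast
  have add: "Poly_Mapping.single m (x + y) \<in> S (ray_cone \<rho>)"
    if "Poly_Mapping.single m x \<in> S (ray_cone \<rho>)" "Poly_Mapping.single m y \<in> S (ray_cone \<rho>)"
    for m x y
    using sub that unfolding submod_def single_add by blast
  have scale: "Poly_Mapping.single m (smul c x) \<in> S (ray_cone \<rho>)"
    if "Poly_Mapping.single m x \<in> S (ray_cone \<rho>)" for m x c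
  proof -
    have "act smul (Poly_Mapping.single 0 c) (Poly_Mapping.single m x)
        = Poly_Mapping.single m (smul c x)"
      by (intro poly_mapping_eqI)
        (simp add: lookup_act_constant[OF vs] lookup_single when_def)
    moreover have "Poly_Mapping.single 0 c \<in> regular_functions (ray_cone \<rho>)"
      by (simp add: regular_functions_def dual_cone_ray_cone_iff)
    ultimately show ?thesis using sub that unfolding submod_def by metis
  qed
  have "Poly_Mapping.single m 0 \<in> S (ray_cone \<rho>)" for m
    using sub by (simp add: submod_def)
  then show ?thesis
    unfolding subspace_def by (auto simp: filtration_def add scale)
qed

text \<open>Multiplication by \<open>\<chi>\<^sup>u\<close> with \<open>\<langle>u, \<rho>\<rangle> = k \<ge> 0\<close>, a regular function on \<open>U\<^sub>\<rho>\<close>, lowers the index of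
  the filtration by \<open>k\<close>; primitivity of \<open>\<rho>\<close> provides such a \<open>u\<close> for every \<open>k\<close>.\<close>

lemma filtration_antimono:
  assumes vs: "vector_space smul" and ts: "toric_sheaf smul \<Sigma> S" and \<rho>: "\<rho> \<in> rays \<Sigma>"
    and "l \<le> l'"
  shows "filtration S \<rho> l' \<subseteq> filtration S \<rho> l"
proof
  fix e assume e: "e \<in> filtration S \<rho> l'"
  have sub: "submod smul (regular_functions (ray_cone \<rho>)) (S (ray_cone \<rho>))"
    using ts \<rho> unfolding toric_sheaf_def rays_def by blast
  obtain u where u: "pairing u \<rho> = 1" using \<rho> primitive_dual unfolding rays_def by blast
  define v where "v = (l' - l) *s u"
  have v: "pairing v \<rho> = l' - l" by (simp add: v_def u)
  then have reg: "Poly_Mapping.single v 1 \<in> regular_functions (ray_cone \<rho>)"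
    using assms(4) by (simp add: regular_functions_def dual_cone_ray_cone_iff)
  have "Poly_Mapping.single m e \<in> S (ray_cone \<rho>)" if "pairing m \<rho> = - l" for m
  proof -
    have "Poly_Mapping.single (m - v) e \<in> S (ray_cone \<rho>)"
      using e that by (simp add: filtration_def v)
    then have "act smul (Poly_Mapping.single v 1) (Poly_Mapping.single (m - v) e) \<in> S (ray_cone \<rho>)"
      using sub reg unfolding submod_def by blast
    then show ?thesis by (simp add: act_single[OF vs])
  qed
  then show "e \<in> filtration S \<rho> l" by (simp add: filtration_def)
qed

section \<open>Contractions and the filtration of the tensor product\<close>

lemma vector_space_scale_tensor:
  assumes "vector_space smul"
  shows "vector_space (scale_tensor smul)"
proof -
  interpret vector_space smul by fact
  show ?thesis
    by unfold_locales
      (simp_all add: scale_tensor_def vec_eq_iff scale_right_distrib scale_left_distrib)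
qed

lemma contract_linear:
  assumes "vector_space smul"
  shows "contract smul s 0 = 0"
    and "contract smul s (w + w') = contract smul s w + contract smul s w'"
    and "contract smul s (scale_tensor smul c w) = smul c (contract smul s w)"
proof -
  interpret vector_space smul by fact
  show "contract smul s 0 = 0"
    by (simp add: contract_def)
  show "contract smul s (w + w') = contract smul s w + contract smul s w'"
    by (simp add: contract_def scale_right_distrib sum.distrib)
  show "contract smul s (scale_tensor smul c w) = smul c (contract smul s w)"
    by (simp add: contract_def scale_tensor_def scale_sum_right mult.commute)
qed

lemma contract_tensor_lattice:
  assumes "vector_space smul"
  shows "contract smul s (tensor smul e (c *s complex_of_lattice \<rho>))
    = smul (c * of_int (pairing s \<rho>)) e"
  by (simp add: contract_tensor[OF assms] complex_of_lattice_def pairing_def sum_distrib_left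
      mult.left_commute)

text \<open>A generator \<open>e \<otimes> v\<close> loses an index of the filtration under contraction only if \<open>v\<close> has weight 1;
  then \<open>v\<close> lies on the line of \<open>\<rho>\<close> and \<open>\<rho>\<^sup>\<bottom>\<close> kills it. Conversely, \<open>u\<close> serves to split off the
  component of \<open>w\<close> along \<open>\<rho>\<close>: its coefficient is a contraction with \<open>u \<notin> \<rho>\<^sup>\<bottom>\<close>, while the
  coordinates of the rest are contractions with elements of \<open>\<rho>\<^sup>\<bottom>\<close>.\<close>

lemma tensor_tangent_filtration_iff:
  fixes F :: "int ^ 'n \<Rightarrow> int \<Rightarrow> 'e::ab_group_add set"
  assumes vs: "vector_space smul"
    and sub: "\<And>l. module.subspace smul (F \<rho> l)"
    and dec: "\<And>l l'. l \<le> l' \<Longrightarrow> F \<rho> l' \<subseteq> F \<rho> l"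
    and u: "pairing u \<rho> = 1"
  shows "w \<in> tensor_tangent_filtration smul F \<rho> l \<longleftrightarrow>
    (\<forall>s. contract smul s w \<in> (if pairing s \<rho> = 0 then F \<rho> l else F \<rho> (l - 1)))"
proof -
  interpret E: vector_space smul by fact
  interpret W: vector_space "scale_tensor smul" using vs by (rule vector_space_scale_tensor)
  let ?G = "{tensor smul e v | e v i j. i + j = l \<and> e \<in> F \<rho> i \<and> v \<in> tangent_filtration \<rho> j}"
  let ?H = "\<lambda>s. if pairing s \<rho> = 0 then F \<rho> l else F \<rho> (l - 1)"
  have subH: "E.subspace (?H s)" for s using sub by simp
  have generators: "contract smul s x \<in> ?H s" if "x \<in> ?G" for s x
  proof -
    obtain e v i j where x: "x = tensor smul e v" and ij: "i + j = l" and e: "e \<in> F \<rho> i"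
      and v: "v \<in> tangent_filtration \<rho> j" using \<open>x \<in> ?G\<close> by blast
    consider "j \<le> 0" | "j = 1" | "j \<ge> 2" by linarith
    then show ?thesis
    proof cases
      case 1
      then have "e \<in> F \<rho> l" "e \<in> F \<rho> (l - 1)"
        using e ij dec[of l i] dec[of "l - 1" i] by auto
      then have "e \<in> ?H s" by simp
      then show ?thesis
        unfolding x contract_tensor[OF vs] by (rule E.subspace_scale[OF subH])
    next
      case 2
      then obtain c where c: "v = c *s complex_of_lattice \<rho>"
        using v by (auto simp: tangent_filtration_def)
      have "i = l - 1" using 2 ij by simp
      then have "e \<in> F \<rho> (l - 1)" using e by simp
      then show ?thesis
        unfolding x c contract_tensor_lattice[OF vs]
        by (auto intro: E.subspace_scale[OF sub] E.subspace_0[OF sub])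
    next
      case 3
      then have "v = 0" using v by (auto simp: tangent_filtration_def)
      then show ?thesis
        unfolding x contract_tensor[OF vs] using E.subspace_0[OF subH[of s]] by simp
    qed
  qed
  show ?thesis
  proof
    assume w: "w \<in> tensor_tangent_filtration smul F \<rho> l"
    show "\<forall>s. contract smul s w \<in> ?H s"
    proof
      fix s
      have "W.subspace {w. contract smul s w \<in> ?H s}"
        by (rule W.subspaceI)
          (use subH[of s] in \<open>simp_all only: mem_Collect_eq contract_linear[OF vs]
            E.subspace_0 E.subspace_add E.subspace_scale\<close>)
      then have "W.span ?G \<subseteq> {w. contract smul s w \<in> ?H s}"
        using generators by (intro W.span_minimal) blast+
      then show "contract smul s w \<in> ?H s"
        using w unfolding tensor_tangent_filtration_def by blast
    qed
  next
    assume H: "\<forall>s. contract smul s w \<in> ?H s"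
    define e where "e = contract smul u w"
    have "contract smul u w \<in> ?H u" using H by blast
    then have eF: "e \<in> F \<rho> (l - 1)" using u by (simp add: e_def)
    define w' where "w' i = contract smul (axis i 1 - \<rho> $ i *s u) w" for i
    have wF: "w' i \<in> F \<rho> l" for i
    proof -
      have "contract smul (axis i 1 - \<rho> $ i *s u) w \<in> ?H (axis i 1 - \<rho> $ i *s u)"
        using H by blast
      then show ?thesis by (simp add: w'_def u)
    qed
    have w': "w' i = w $ i - smul (of_int (\<rho> $ i)) e" for i
    proof -
      have "contract smul (axis i 1) w = w $ i"
        unfolding contract_def axis_def
        by (subst sum.remove[of _ i]) auto
      then show ?thesis
        by (simp add: w'_def e_def contract_def E.scale_left_diff_distrib sum_subtractf
            E.scale_sum_right)
    qed
    have split: "w = tensor smul e (complex_of_lattice \<rho>) + (\<Sum>i\<in>UNIV. tensor smul (w' i) (axis i 1))"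
    proof -
      have "(\<Sum>i\<in>UNIV. tensor smul (w' i) (axis i 1)) $ k = w' k" for k
      proof -
        have "(\<Sum>i\<in>UNIV. tensor smul (w' i) (axis i 1)) $ k
            = (\<Sum>i\<in>UNIV. smul (axis i 1 $ k) (w' i))"
          by (simp add: tensor_def)
        also have "\<dots> = w' k"
          by (subst sum.remove[of _ k]) (auto simp: axis_def)
        finally show ?thesis .
      qed
      then show ?thesis
        by (simp add: vec_eq_iff w') (simp add: tensor_def complex_of_lattice_def)
    qed
    have "complex_of_lattice \<rho> \<in> tangent_filtration \<rho> 1"
      by (auto simp: tangent_filtration_def intro: range_eqI[of _ _ 1])
    with eF have "tensor smul e (complex_of_lattice \<rho>) \<in> ?G"
      using diff_add_cancel[of l 1] by blast
    then have along: "tensor smul e (complex_of_lattice \<rho>) \<in> W.span ?G"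
      by (rule W.span_base)
    have "tensor smul (w' i) (axis i 1) \<in> ?G" for i
    proof -
      have "axis i 1 \<in> tangent_filtration \<rho> 0" by (simp add: tangent_filtration_def)
      then show ?thesis using wF[of i] add_0_right[of l] by blast
    qed
    then have "(\<Sum>i\<in>UNIV. tensor smul (w' i) (axis i 1)) \<in> W.span ?G"
      by (intro W.span_sum W.span_base)
    with along have "w \<in> W.span ?G"
      unfolding split by (rule W.span_add)
    then show "w \<in> tensor_tangent_filtration smul F \<rho> l"
      by (simp add: tensor_tangent_filtration_def)
  qed
qed

section \<open>Homogeneous pre-Higgs fields\<close>

text \<open>The morphism \<open>\<phi> \<otimes> \<chi>\<^sup>r\<close> of modules over \<open>\<complex>[M]\<close>.\<close>

definition shifted_map :: "int ^ 'n \<Rightarrow> ('e \<Rightarrow> 'v) \<Rightarrow> ((int ^ 'n) \<Rightarrow>\<^sub>0 'e::ab_group_add)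
    \<Rightarrow> ((int ^ 'n) \<Rightarrow>\<^sub>0 'v::ab_group_add)" where
  "shifted_map r \<phi> f = Poly_Mapping.map \<phi> (Poly_Mapping.map_key (\<lambda>m. m - r) f)"

lemma lookup_shifted_map:
  assumes "\<phi> 0 = 0"
  shows "Poly_Mapping.lookup (shifted_map r \<phi> f) m = \<phi> (Poly_Mapping.lookup f (m - r))"
proof -
  have "inj (\<lambda>m. m - r)" by (rule injI) simp
  then show ?thesis
    by (simp add: shifted_map_def map.rep_eq map_key.rep_eq when_def assms)
qed

lemma shifted_map_act:
  assumes "Vector_Spaces.linear smul smul' \<phi>"
  shows "shifted_map r \<phi> (act smul p f) = act smul' p (shifted_map r \<phi> f)"
proof -
  interpret Vector_Spaces.linear smul smul' \<phi> by fact
  show ?thesis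
    by (intro poly_mapping_eqI)
      (simp add: lookup_shifted_map zero lookup_act[OF vs1.vector_space_axioms]
        lookup_act[OF vs2.vector_space_axioms] sum scale algebra_simps)
qed

lemma shifted_map_torus_action:
  assumes "Vector_Spaces.linear smul smul' \<phi>" and t: "t \<in> torus"
  shows "shifted_map r \<phi> (torus_action smul t f) = twisted_action smul' r t (shifted_map r \<phi> f)"
proof -
  interpret Vector_Spaces.linear smul smul' \<phi> by fact
  have "inverse (character (m - r) t) = character r t * inverse (character m t)" for m
    using character_add[OF t, of "m - r" r] character_nonzero[OF t] by (simp add: field_simps)
  then show ?thesis
    by (intro poly_mapping_eqI)
      (simp add: lookup_shifted_map zero lookup_torus_action[OF vs1.vector_space_axioms]
        lookup_twisted_action[OF vs2.vector_space_axioms] scale)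
qed

text \<open>Both directions compare a chart with a smaller one: sections over \<open>U\<^sub>\<rho>\<close> are restricted to the
  torus to see that a field inducing \<open>\<phi>\<close> acts on them as \<open>\<phi> \<otimes> \<chi>\<^sup>r\<close>, and sections over \<open>U\<^sub>\<sigma>\<close> are
  restricted to \<open>U\<^sub>\<rho>\<close> for the rays \<open>\<rho>\<close> of \<open>\<sigma>\<close>, because these rays alone determine the sections of the
  target.\<close>

lemma induces_homogeneous_pre_higgs_iff:
  fixes \<Sigma> :: "(real ^ 'n) set set"
    and S :: "(real ^ 'n) set \<Rightarrow> ((int ^ 'n) \<Rightarrow>\<^sub>0 'e::ab_group_add) set"
  assumes vs: "vector_space smul" and fan: "fan \<Sigma>" and ts: "toric_sheaf smul \<Sigma> S"
    and lin: "Vector_Spaces.linear smul (scale_tensor smul) \<phi>"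
  shows "induces_homogeneous_pre_higgs smul \<Sigma> S r \<phi> \<longleftrightarrow>
    (\<forall>\<rho>\<in>rays \<Sigma>. \<forall>l. \<phi> ` filtration S \<rho> l \<subseteq>
      tensor_tangent_filtration smul (filtration S) \<rho> (l - pairing r \<rho>))"
    (is "_ \<longleftrightarrow> (\<forall>\<rho>\<in>rays \<Sigma>. \<forall>l. _ \<subseteq> ?TF \<rho> (l - pairing r \<rho>))")
proof
  assume "induces_homogeneous_pre_higgs smul \<Sigma> S r \<phi>"
  then obtain \<Phi> where hom: "sheaf_hom smul (scale_tensor smul) \<Sigma> S (tensor_tangent smul \<Sigma> S) \<Phi>"
    and \<Phi>: "\<And>e m. \<Phi> {0} (Poly_Mapping.single m e) = Poly_Mapping.single (m + r) (\<phi> e)"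
    unfolding induces_homogeneous_pre_higgs_def homogeneous_pre_higgs_def pre_higgs_def by blast
  show "\<forall>\<rho>\<in>rays \<Sigma>. \<forall>l. \<phi> ` filtration S \<rho> l \<subseteq> ?TF \<rho> (l - pairing r \<rho>)"
  proof (intro ballI allI image_subsetI)
    fix \<rho> l e assume \<rho>: "\<rho> \<in> rays \<Sigma>" and e: "e \<in> filtration S \<rho> l"
    have ray: "ray_cone \<rho> \<in> \<Sigma>" and prim: "primitive \<rho>" using \<rho> by (auto simp: rays_def)
    obtain u where u: "pairing u \<rho> = 1" using prim by (rule primitive_dual)
    define m where "m = (- l) *s u"
    have m: "pairing m \<rho> = - l" by (simp add: m_def u del: vector_smult_lneg)
    have f: "Poly_Mapping.single m e \<in> S (ray_cone \<rho>)" using e m by (simp add: filtration_def)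
    have "0 \<in> ray_cone \<rho>"
      by (simp add: ray_cone_def convex_cone_convex_cone_hull convex_cone_contains_0)
    then have "ray_cone \<rho> \<inter> {0} = {0}" by auto
    then have "{0} face_of ray_cone \<rho>"
      using fan fan_zero[OF fan] ray unfolding fan_def by metis
    then have "\<Phi> (ray_cone \<rho>) (Poly_Mapping.single m e) = Poly_Mapping.single (m + r) (\<phi> e)"
      using hom fan_zero[OF fan] ray f \<Phi> unfolding sheaf_hom_def by metis
    moreover have "\<Phi> (ray_cone \<rho>) (Poly_Mapping.single m e)
        \<in> tensor_tangent smul \<Sigma> S (ray_cone \<rho>)"
      using hom ray f unfolding sheaf_hom_def mod_hom_def by blast
    ultimately have "Poly_Mapping.single (m + r) (\<phi> e) \<in> tensor_tangent smul \<Sigma> S (ray_cone \<rho>)"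
      by simp
    then have "\<forall>k. Poly_Mapping.lookup (Poly_Mapping.single (m + r) (\<phi> e)) k
        \<in> ?TF \<rho> (- pairing k \<rho>)"
      using \<rho> unfolding tensor_tangent_def sheaf_of_filtration_def by blast
    from spec[OF this, of "m + r"] show "\<phi> e \<in> ?TF \<rho> (l - pairing r \<rho>)" using m by simp
  qed
next
  assume A: "\<forall>\<rho>\<in>rays \<Sigma>. \<forall>l. \<phi> ` filtration S \<rho> l \<subseteq> ?TF \<rho> (l - pairing r \<rho>)"
  interpret Vector_Spaces.linear smul "scale_tensor smul" \<phi> by fact
  let ?\<Phi> = "\<lambda>\<sigma>::(real ^ 'n) set. shifted_map r \<phi>"
  have maps: "shifted_map r \<phi> f \<in> tensor_tangent smul \<Sigma> S \<sigma>"
    if \<sigma>: "\<sigma> \<in> \<Sigma>" and f: "f \<in> S \<sigma>" for \<sigma> f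
    unfolding tensor_tangent_def sheaf_of_filtration_def
  proof (intro CollectI ballI impI allI)
    fix \<rho> m assume \<rho>: "\<rho> \<in> rays \<Sigma>" and le: "ray_cone \<rho> \<subseteq> \<sigma>"
    have ray: "ray_cone \<rho> \<in> \<Sigma>" using \<rho> by (simp add: rays_def)
    have "\<sigma> \<inter> ray_cone \<rho> = ray_cone \<rho>" using le by blast
    then have "ray_cone \<rho> face_of \<sigma>"
      using fan \<sigma> ray unfolding fan_def by metis
    then have "S (ray_cone \<rho>) = submod smul (regular_functions (ray_cone \<rho>)) hull S \<sigma>"
      using ts \<sigma> ray unfolding toric_sheaf_def by blast
    then have "f \<in> S (ray_cone \<rho>)" using f by (simp add: hull_inc)
    then have "Poly_Mapping.single (m - r) (Poly_Mapping.lookup f (m - r)) \<in> S (ray_cone \<rho>)"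
      using ts ray unfolding toric_sheaf_def
      by (intro homogeneous_component_in[OF vs, of "ray_cone \<rho>"]) blast+
    then have "Poly_Mapping.lookup f (m - r) \<in> filtration S \<rho> (- pairing (m - r) \<rho>)"
      using filtration_iff[OF vs ts \<rho>] by blast
    then have "\<phi> (Poly_Mapping.lookup f (m - r)) \<in> ?TF \<rho> (- pairing (m - r) \<rho> - pairing r \<rho>)"
      using A \<rho> by blast
    then show "Poly_Mapping.lookup (shifted_map r \<phi> f) m \<in> ?TF \<rho> (- pairing m \<rho>)"
      by (simp add: lookup_shifted_map zero)
  qed
  have "shifted_map r \<phi> (f + g) = shifted_map r \<phi> f + shifted_map r \<phi> g" for f g :: "(int ^ 'n) \<Rightarrow>\<^sub>0 'e"
    by (intro poly_mapping_eqI) (simp add: lookup_shifted_map zero lookup_add add)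
  then have "pre_higgs smul \<Sigma> S ?\<Phi>"
    unfolding pre_higgs_def sheaf_hom_def mod_hom_def
    by (simp add: maps shifted_map_act[OF lin])
  then have "homogeneous_pre_higgs smul \<Sigma> S r ?\<Phi>"
    unfolding homogeneous_pre_higgs_def by (simp add: shifted_map_torus_action[OF lin])
  moreover have "shifted_map r \<phi> (Poly_Mapping.single m e) = Poly_Mapping.single (m + r) (\<phi> e)"
    for m e
    by (intro poly_mapping_eqI)
      (auto simp: lookup_shifted_map zero lookup_single when_def algebra_simps)
  ultimately show "induces_homogeneous_pre_higgs smul \<Sigma> S r \<phi>"
    unfolding induces_homogeneous_pre_higgs_def by blast
qed

theorem theorem8:
  fixes smul :: "complex \<Rightarrow> 'e::ab_group_add \<Rightarrow> 'e"
    and \<Sigma> :: "(real ^ 'n) set set"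
    and S :: "(real ^ 'n) set \<Rightarrow> ((int ^ 'n) \<Rightarrow>\<^sub>0 'e) set"
    and r :: "int ^ 'n"
    and \<phi> :: "'e \<Rightarrow> 'e ^ 'n"
  assumes "vector_space smul"
    and "fan \<Sigma>"
    and "toric_sheaf smul \<Sigma> S"
    and "Vector_Spaces.linear smul (scale_tensor smul) \<phi>"
  shows "(induces_homogeneous_pre_higgs smul \<Sigma> S r \<phi> \<longleftrightarrow>
      (\<forall>s. \<forall>\<rho>\<in>rays \<Sigma>. \<forall>l.
         (contract smul s \<circ> \<phi>) ` filtration S \<rho> l \<subseteq>
           (if pairing s \<rho> = 0 then filtration S \<rho> (l - pairing r \<rho>)
            else filtration S \<rho> (l - 1 - pairing r \<rho>)))) \<and>
    (\<forall>\<rho>\<in>rays \<Sigma>. \<forall>l.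
       filtration S \<rho> (l - pairing r \<rho>) \<subseteq> filtration S \<rho> (l - 1 - pairing r \<rho>))"
proof
  note vs = assms(1) and ts = assms(3)
  let ?R = "\<lambda>s \<rho> l. if pairing s \<rho> = 0 then filtration S \<rho> (l - pairing r \<rho>)
    else filtration S \<rho> (l - 1 - pairing r \<rho>)"
  have "w \<in> tensor_tangent_filtration smul (filtration S) \<rho> (l - pairing r \<rho>) \<longleftrightarrow>
      (\<forall>s. contract smul s w \<in> ?R s \<rho> l)" if \<rho>: "\<rho> \<in> rays \<Sigma>" for \<rho> l w
  proof -
    obtain u where u: "pairing u \<rho> = 1" using \<rho> primitive_dual unfolding rays_def by blast
    have eq: "l - pairing r \<rho> - 1 = l - 1 - pairing r \<rho>" by simp
    show ?thesis
      using tensor_tangent_filtration_iff[where F = "filtration S" and \<rho> = \<rho>,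
          OF vs filtration_subspace[OF vs ts \<rho>]
          filtration_antimono[OF vs ts \<rho>] u, of w "l - pairing r \<rho>"]
      unfolding eq .
  qed
  then show "induces_homogeneous_pre_higgs smul \<Sigma> S r \<phi> \<longleftrightarrow>
      (\<forall>s. \<forall>\<rho>\<in>rays \<Sigma>. \<forall>l. (contract smul s \<circ> \<phi>) ` filtration S \<rho> l \<subseteq> ?R s \<rho> l)"
    unfolding induces_homogeneous_pre_higgs_iff[OF assms] image_subset_iff o_def
    by blast
  show "\<forall>\<rho>\<in>rays \<Sigma>. \<forall>l.
      filtration S \<rho> (l - pairing r \<rho>) \<subseteq> filtration S \<rho> (l - 1 - pairing r \<rho>)"
    using filtration_antimono[OF vs ts] by simp
qed

end
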